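(* For positive integers $n_1,\dots,n_k$, \[ \mathrm{gp}^-(K_{n_1} \,\square\, K_{n_2} \,\square\, \cdots \,\square\, K_{n_k}) = \min\{n_1,n_2,\dots,n_k\}. \]
   Context: $K_n$ is the complete graph on $n$ vertices. A set $S$ of vertices of a graph $G$ is in general position if no shortest path of $G$ contains three vertices of $S$; $\mathrm{gp}^-(G)$ is the order of a smallest maximal general position set of $G$. The Cartesian product $G \,\square\, H$ has vertex set $V(G)\times V(H)$, with $(u_1,v_1) \sim (u_2,v_2)$ iff either $u_1=u_2$ and $v_1 \sim v_2$ in $H$, or $u_1 \sim u_2$ in $G$ and $v_1 = v_2$; it is associative up to isomorphism.
   Formalization: Proved under the added assumption that if some n_i = 1 then all n_i = 1; otherwise the claim is false, e.g. K_1 □ K_2 is K_2, so gp^- = 2 while min{1,2} = 1 (it fails for every excluded tuple). *)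

theory Defs
  imports "Graph_Theory.Graph_Theory"
begin

text \<open>
  Following Graph\_Theory, a finite simple graph is a digraph with a symmetric, irreflexive set of
  arcs (\<^locale>\<open>pair_graph\<close>). Paths are the vertex lists \<^const>\<open>vpath\<close>.
\<close>

definition complete_graph :: "nat \<Rightarrow> nat pair_pre_digraph" where
  "complete_graph n =
     \<lparr>pverts = {..<n}, parcs = {(u, v). u < n \<and> v < n \<and> u \<noteq> v}\<rparr>"

definition cart_prod ::
  "'a pair_pre_digraph \<Rightarrow> 'b pair_pre_digraph \<Rightarrow> ('a \<times> 'b) pair_pre_digraph"
  (infixr \<open>\<box>\<close> 70) where
  "G \<box> H =
     \<lparr>pverts = pverts G \<times> pverts H,
      parcs = {((u1, v1), (u2, v2)).
        (u1 \<in> pverts G \<and> u1 = u2 \<and> (v1, v2) \<in> parcs H) \<or>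
        ((u1, u2) \<in> parcs G \<and> v1 \<in> pverts H \<and> v1 = v2)}\<rparr>"

definition relabel :: "('a \<Rightarrow> 'b) \<Rightarrow> 'a pair_pre_digraph \<Rightarrow> 'b pair_pre_digraph" where
  "relabel f G = \<lparr>pverts = f ` pverts G, parcs = map_prod f f ` parcs G\<rparr>"

text \<open>
  The k-fold product, bracketed to the right. Its vertices are lists of length k instead of nested
  pairs, because the type of a nested pair would depend on k; the bijection
  \<open>(x, xs) \<mapsto> x # xs\<close> transports the binary product. The empty product is the one-vertex graph,
  the unit of the product.
\<close>

fun cart_prod_list :: "'a pair_pre_digraph list \<Rightarrow> 'a list pair_pre_digraph" where
  "cart_prod_list [] = \<lparr>pverts = {[]}, parcs = {}\<rparr>"
| "cart_prod_list (G # Gs) = relabel (\<lambda>(x, xs). x # xs) (G \<box> cart_prod_list Gs)"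

definition shortest_path :: "'a pair_pre_digraph \<Rightarrow> 'a list \<Rightarrow> bool" where
  "shortest_path G p \<longleftrightarrow>
     vpath p (with_proj G) \<and>
     (\<forall>q. vpath q (with_proj G) \<and> hd q = hd p \<and> last q = last p
        \<longrightarrow> vwalk_length p \<le> vwalk_length q)"

definition general_position :: "'a pair_pre_digraph \<Rightarrow> 'a set \<Rightarrow> bool" where
  "general_position G S \<longleftrightarrow>
     S \<subseteq> pverts G \<and> \<not> (\<exists>p. shortest_path G p \<and> card (set p \<inter> S) \<ge> 3)"

definition maximal_general_position :: "'a pair_pre_digraph \<Rightarrow> 'a set \<Rightarrow> bool" where
  "maximal_general_position G S \<longleftrightarrow>
     general_position G S \<and> (\<forall>T. general_position G T \<and> S \<subseteq> T \<longrightarrow> T = S)"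

definition gp_minus :: "'a pair_pre_digraph \<Rightarrow> nat" where
  "gp_minus G = (LEAST m. \<exists>S. maximal_general_position G S \<and> card S = m)"

lemma complete_digraph_complete_graph: "complete_digraph n (with_proj (complete_graph n))"
  by (auto simp: complete_digraph_pair_def complete_graph_def)

lemma pair_graph_complete_graph: "pair_graph (complete_graph n)"
  by (rule pair_graphI_complete[OF complete_digraph_complete_graph])

lemma pverts_cart_prod_list_Cons:
  "x # xs \<in> pverts (cart_prod_list (G # Gs)) \<longleftrightarrow>
     x \<in> pverts G \<and> xs \<in> pverts (cart_prod_list Gs)"
  by (auto simp: relabel_def cart_prod_def)

lemma parcs_cart_prod_list_Cons:
  "(x # xs, y # ys) \<in> parcs (cart_prod_list (G # Gs)) \<longleftrightarrow>
     (x \<in> pverts G \<and> x = y \<and> (xs, ys) \<in> parcs (cart_prod_list Gs)) \<or>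
     ((x, y) \<in> parcs G \<and> xs \<in> pverts (cart_prod_list Gs) \<and> xs = ys)"
  by (auto simp: relabel_def cart_prod_def image_iff split: prod.splits)

lemma general_position_card_le_2:
  assumes "finite S" "S \<subseteq> pverts G" "card S \<le> 2"
  shows "general_position G S"
  unfolding general_position_def
proof (intro conjI notI)
  assume "\<exists>p. shortest_path G p \<and> card (set p \<inter> S) \<ge> 3"
  then obtain p where "card (set p \<inter> S) \<ge> 3" by blast
  moreover have "card (set p \<inter> S) \<le> card S" using assms(1) by (intro card_mono) auto
  ultimately show False using assms(3) by simp
qed (use assms in simp)

text \<open>
  The product of the one-vertex graph with an edge is an edge, whose only maximal general position
  set has order 2. So the order of a smallest maximal general position set can exceed the smallest
  order of a factor when trivial and nontrivial factors are mixed.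
\<close>

lemma gp_minus_K1_K2: "gp_minus (cart_prod_list (map complete_graph [1, 2])) = 2"
proof -
  let ?G = "cart_prod_list (map complete_graph [1, 2])"
  have "{..<1::nat} = {0}" "{..<2::nat} = {0, 1}" by auto
  then have V: "pverts ?G = {[0, 0], [0, 1]}"
    by (simp add: relabel_def cart_prod_def complete_graph_def)
  have gp: "general_position ?G (pverts ?G)"
    unfolding V by (rule general_position_card_le_2) (simp_all only: V, simp_all)
  have max: "maximal_general_position ?G S \<longleftrightarrow> S = pverts ?G" for S
    using gp unfolding maximal_general_position_def general_position_def by blast
  have "gp_minus ?G = (LEAST m. card (pverts ?G) = m)"
    unfolding gp_minus_def max by (simp only: simp_thms)
  also have "\<dots> = card (pverts ?G)"
    by (rule Least_equality) (rule refl, rule eq_imp_le)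
  also have "\<dots> = 2" unfolding V by simp
  finally show ?thesis .
qed

end

theory Submission
  imports Defs
begin

text \<open>
  In a product of complete graphs the distance is the Hamming distance, so \<open>y\<close> lies on a shortest
  path from \<open>x\<close> to \<open>z\<close> iff every coordinate of \<open>y\<close> agrees with that of \<open>x\<close> or of \<open>z\<close>.
  A set with fewer elements than every factor misses some value in each coordinate; a vertex
  composed of missed values can be added to it, so it is not maximal. Conversely, let \<open>L\<close> be a line
  in the direction of a smallest factor. A vertex \<open>w\<close> outside \<open>L\<close> has a projection to \<open>L\<close>,
  which lies between \<open>w\<close> and any other point of \<open>L\<close>. So \<open>L\<close> is maximal.
\<close>

section \<open>General position in terms of a distance function\<close>

text \<open>Erasing a loop deletes at least one entry. Hence a walk of least length between its ends
  is already a path.\<close>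

lemma vwalk_to_vpath_eq_or_shorter:
  "vwalk_to_vpath p = p \<or> length (vwalk_to_vpath p) < length p"
proof (induction p rule: vwalk_to_vpath_induct3)
  case (in_set x xs)
  have "length (dropWhile (\<lambda>y. y \<noteq> x) xs) \<le> length xs"
    by (rule length_dropWhile_le)
  with in_set show ?case
    by auto
qed auto

text \<open>The two assumptions say that \<open>d\<close> is the graph distance measured by walks,
  whereas \<open>shortest_path\<close> compares paths only. Loop erasure bridges the two: it keeps
  both ends and never lengthens a walk.\<close>

lemma shortest_path_iff_length_eq:
  fixes d :: "'a \<Rightarrow> 'a \<Rightarrow> nat"
  assumes walk_ge: "\<And>p. vwalk p (with_proj G) \<Longrightarrow> d (hd p) (last p) \<le> vwalk_length p"
    and geodesic: "\<And>u v. u \<in> pverts G \<Longrightarrow> v \<in> pverts G \<Longrightarrow>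
      \<exists>p. vwalk p (with_proj G) \<and> hd p = u \<and> last p = v \<and> vwalk_length p = d u v"
  shows "shortest_path G p \<longleftrightarrow> vwalk p (with_proj G) \<and> vwalk_length p = d (hd p) (last p)"
proof
  assume sp: "shortest_path G p"
  then have p: "vwalk p (with_proj G)"
    by (auto simp: shortest_path_def)
  then have "hd p \<in> pverts G" "last p \<in> pverts G"
    by (metis hd_in_set last_in_set vwalkE vwalk_verts_in_verts with_proj_simps(1))+
  then obtain q where q: "vwalk q (with_proj G)" "hd q = hd p" "last q = last p"
      "vwalk_length q = d (hd p) (last p)"
    using geodesic by blast
  have "vwalk_length p \<le> vwalk_length (vwalk_to_vpath q)"
    using sp vwalk_to_vpath_vpath[OF q(1)] q(2,3)
    unfolding shortest_path_def by (metis vwalk_to_vpath_hd vwalk_to_vpath_last)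
  also have "\<dots> \<le> vwalk_length q"
    using vwalk_to_vpath_eq_or_shorter[of q] by auto
  finally show "vwalk p (with_proj G) \<and> vwalk_length p = d (hd p) (last p)"
    using p q(4) walk_ge[OF p] by simp
next
  assume p: "vwalk p (with_proj G) \<and> vwalk_length p = d (hd p) (last p)"
  let ?q = "vwalk_to_vpath p"
  have q: "vpath ?q (with_proj G)"
    using p vwalk_to_vpath_vpath by blast
  then have "d (hd p) (last p) \<le> vwalk_length ?q"
    using walk_ge[of ?q] by (auto simp: vwalk_to_vpath_hd vwalk_to_vpath_last)
  \<comment> \<open>\<open>vwalk_length\<close> is a truncated \<open>length - 1\<close>;
    nonemptiness makes the bounds on it bounds on \<open>length\<close>, so \<open>?q\<close> cannot
    be shorter than \<open>p\<close>.\<close>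
  moreover have "?q \<noteq> []"
    using q by auto
  ultimately have "?q = p"
    using p vwalk_to_vpath_eq_or_shorter[of p] by (cases ?q) auto
  with q have "vpath p (with_proj G)"
    by simp
  then show "shortest_path G p"
    using p walk_ge unfolding shortest_path_def by (metis vpathE)
qed

text \<open>Three vertices on a shortest path give equality in the triangle inequality. Conversely,
  if equality holds, geodesics from \<open>x\<close> to \<open>y\<close> and from \<open>y\<close>
  to \<open>z\<close> concatenate to a shortest path.\<close>

lemma general_position_iff_no_between:
  fixes d :: "'a \<Rightarrow> 'a \<Rightarrow> nat"
  assumes walk_ge: "\<And>p. vwalk p (with_proj G) \<Longrightarrow> d (hd p) (last p) \<le> vwalk_length p"
    and geodesic: "\<And>u v. u \<in> pverts G \<Longrightarrow> v \<in> pverts G \<Longrightarrow>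
      \<exists>p. vwalk p (with_proj G) \<and> hd p = u \<and> last p = v \<and> vwalk_length p = d u v"
  shows "general_position G S \<longleftrightarrow> S \<subseteq> pverts G \<and>
    (\<forall>x\<in>S. \<forall>y\<in>S. \<forall>z\<in>S. distinct [x, y, z] \<longrightarrow> d x z \<noteq> d x y + d y z)"
proof (cases "S \<subseteq> pverts G")
  case True
  note sp = shortest_path_iff_length_eq[of G d, OF walk_ge geodesic]
  \<comment> \<open>This concatenation serves twice: it yields the triangle inequality for
    \<open>d\<close>, and in the converse direction the shortest path through
    \<open>y\<close>.\<close>
  have join: "\<exists>p. vwalk p (with_proj G) \<and> hd p = x \<and> last p = z \<and> y \<in> set p \<and>
      vwalk_length p = d x y + d y z"
    if xyz: "x \<in> pverts G" "y \<in> pverts G" "z \<in> pverts G" for x y z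
  proof -
    obtain p where p: "vwalk p (with_proj G)" "hd p = x" "last p = y" "vwalk_length p = d x y"
      using geodesic xyz by blast
    obtain q where q: "vwalk q (with_proj G)" "hd q = y" "last q = z" "vwalk_length q = d y z"
      using geodesic xyz by blast
    have j: "joinable p q"
      using p q by auto
    have "y \<in> set (p \<oplus> q)"
      using p j last_in_set[of p] by (auto simp: vwalk_join_def)
    then show ?thesis
      using p q j vwalk_joinI_vwalk[OF p(1) q(1) j] vwalk_join_hd[OF j] vwalk_join_last[OF j]
        vwalk_join_vwalk_length[OF j] by metis
  qed
  have triangle: "d x z \<le> d x y + d y z"
    if "x \<in> pverts G" "y \<in> pverts G" "z \<in> pverts G" for x y z
    using join[OF that] walk_ge by metis
  have "(\<exists>p. shortest_path G p \<and> card (set p \<inter> S) \<ge> 3) \<longleftrightarrow>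
    (\<exists>x\<in>S. \<exists>y\<in>S. \<exists>z\<in>S. distinct [x, y, z] \<and> d x z = d x y + d y z)"
  proof
    assume "\<exists>p. shortest_path G p \<and> card (set p \<inter> S) \<ge> 3"
    then obtain p where p: "shortest_path G p" and card: "card (set p \<inter> S) \<ge> 3"
      by blast
    have dist: "distinct p"
      using p by (auto simp: shortest_path_def)
    have "set (filter (\<lambda>v. v \<in> S) p) = set p \<inter> S"
      by auto
    \<comment> \<open>Filtering keeps the order along \<open>p\<close>, so \<open>x\<close>,
      \<open>y\<close>, \<open>z\<close> are the first three members of \<open>S\<close> that the
      path meets.\<close>
    then have "length (filter (\<lambda>v. v \<in> S) p) \<ge> 3"
      using card dist distinct_card[of "filter (\<lambda>v. v \<in> S) p"] by simp
    then obtain x y z vs where "filter (\<lambda>v. v \<in> S) p = x # y # z # vs"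
      by (auto simp: numeral_3_eq_3 Suc_le_length_iff)
    then obtain a q1 where q1: "p = a @ x # q1" "x \<in> S" "filter (\<lambda>v. v \<in> S) q1 = y # z # vs"
      by (metis filter_eq_Cons_iff)
    then obtain b q2 where q2: "q1 = b @ y # q2" "y \<in> S" "filter (\<lambda>v. v \<in> S) q2 = z # vs"
      by (metis filter_eq_Cons_iff)
    then obtain c e where "q2 = c @ z # e" "z \<in> S"
      by (metis filter_eq_Cons_iff)
    with q1 q2 have xyz: "p = a @ x # b @ y # c @ z # e" "x \<in> S" "y \<in> S" "z \<in> S"
      by simp_all
    have pw: "vwalk p (with_proj G)" and len: "length p - 1 = d (hd p) (last p)"
      using p sp by auto
    have "vwalk (a @ [x]) (with_proj G)"
      using pw vwalkI_append_l[of "a @ [x]" "b @ y # c @ z # e"] xyz(1) by simp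
    then have 1: "d (hd p) x \<le> length a"
      using walk_ge[of "a @ [x]"] xyz(1) by (cases a) auto
    have r1: "vwalk (x # b @ y # c @ z # e) (with_proj G)"
      using pw vwalkI_append_r[of "x # b @ y # c @ z # e" a] xyz(1) by simp
    then have "vwalk (x # b @ [y]) (with_proj G)"
      using vwalkI_append_l[of "x # b @ [y]" "c @ z # e"] by simp
    then have 2: "d x y \<le> length b + 1"
      using walk_ge[of "x # b @ [y]"] by simp
    have r2: "vwalk (y # c @ z # e) (with_proj G)"
      using r1 vwalkI_append_r[of "y # c @ z # e" "x # b"] by simp
    then have "vwalk (y # c @ [z]) (with_proj G)"
      using vwalkI_append_l[of "y # c @ [z]" e] by simp
    then have 3: "d y z \<le> length c + 1"
      using walk_ge[of "y # c @ [z]"] by simp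
    have "vwalk (z # e) (with_proj G)"
      using r2 vwalkI_append_r[of "z # e" "y # c"] by simp
    then have 4: "d z (last p) \<le> length e"
      using walk_ge[of "z # e"] xyz(1) by simp
    have "p \<noteq> []"
      using xyz(1) by simp
    then have "hd p \<in> set p" "last p \<in> set p"
      by simp_all
    then have V: "hd p \<in> pverts G" "last p \<in> pverts G" "x \<in> pverts G" "y \<in> pverts G" "z \<in> pverts G"
      using vwalk_verts_in_verts[OF pw] xyz(2-) True by auto
    \<comment> \<open>The four segments have total length \<open>d (hd p) (last p)\<close>.
      Cancelling the outer two leaves \<open>d x z\<close> at least the length of the middle two,
      hence at least \<open>d x y + d y z\<close>.\<close>
    have "d (hd p) (last p) \<le> d (hd p) x + d x z + d z (last p)"
      using triangle[of "hd p" x "last p"] triangle[of x z "last p"] V by simp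
    then have "d x z = d x y + d y z"
      using 1 2 3 4 len xyz(1) triangle[of x y z] V by simp
    then show "\<exists>x\<in>S. \<exists>y\<in>S. \<exists>z\<in>S. distinct [x, y, z] \<and> d x z = d x y + d y z"
      using xyz dist by (intro bexI[of _ x] bexI[of _ y] bexI[of _ z]) auto
  next
    assume "\<exists>x\<in>S. \<exists>y\<in>S. \<exists>z\<in>S. distinct [x, y, z] \<and> d x z = d x y + d y z"
    then obtain x y z where xyz: "x \<in> S" "y \<in> S" "z \<in> S" "distinct [x, y, z]"
        "d x z = d x y + d y z"
      by blast
    then obtain p where p: "vwalk p (with_proj G)" "hd p = x" "last p = z" "y \<in> set p"
        "vwalk_length p = d x z"
      using join[of x y z] True by auto
    have "p \<noteq> []"
      using p by auto
    then have "{x, y, z} \<subseteq> set p \<inter> S"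
      using p xyz by auto
    then have "card {x, y, z} \<le> card (set p \<inter> S)"
      by (intro card_mono) auto
    moreover have "card {x, y, z} = 3"
      using xyz(4) by auto
    moreover have "shortest_path G p"
      using p sp by simp
    ultimately show "\<exists>p. shortest_path G p \<and> card (set p \<inter> S) \<ge> 3"
      by auto
  qed
  then show ?thesis
    using True unfolding general_position_def by blast
qed (simp add: general_position_def)

section \<open>Hamming distance and betweenness\<close>

text \<open>Entries beyond the shorter list count 0, which is why the metric laws below assume equal
  lengths.\<close>

fun hamming :: "'a list \<Rightarrow> 'a list \<Rightarrow> nat" where
  "hamming (x # xs) (y # ys) = of_bool (x \<noteq> y) + hamming xs ys"
| "hamming _ _ = 0"

lemma hamming_self [simp]: "hamming xs xs = 0"
  by (induction xs) auto

lemma hamming_eq_0_iff: "length xs = length ys \<Longrightarrow> hamming xs ys = 0 \<longleftrightarrow> xs = ys"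
  by (induction xs ys rule: list_induct2) auto

lemma hamming_triangle:
  assumes "length xs = length ys" "length ys = length zs"
  shows "hamming xs zs \<le> hamming xs ys + hamming ys zs"
  using assms by (induction xs ys zs rule: list_induct3) auto

text \<open>The triangle inequality holds in each coordinate separately, so no coordinate can make
  up for slack in another: equality of the sums forces equality everywhere.\<close>

lemma hamming_between_iff:
  assumes "length xs = length ys" "length ys = length zs"
  shows "hamming xs zs = hamming xs ys + hamming ys zs \<longleftrightarrow>
    (\<forall>i<length xs. ys ! i = xs ! i \<or> ys ! i = zs ! i)"
  using assms
proof (induction xs ys zs rule: list_induct3)
  case (Cons x xs y ys z zs)
  have "hamming xs zs \<le> hamming xs ys + hamming ys zs"
    using Cons by (intro hamming_triangle) auto
  with Cons show ?case
    by (auto simp: All_less_Suc2)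
qed simp

section \<open>Vertices, arcs and distance in a product of complete graphs\<close>

lemma pverts_complete_product_iff:
  "xs \<in> pverts (cart_prod_list (map complete_graph ns)) \<longleftrightarrow> list_all2 (<) xs ns"
proof (induction ns arbitrary: xs)
  case (Cons n ns)
  show ?case
  proof (cases xs)
    case Nil
    then show ?thesis
      by (auto simp: relabel_def)
  next
    case (Cons x xs')
    then show ?thesis
      using Cons.IH[of xs'] pverts_cart_prod_list_Cons[of x xs' "complete_graph n"]
      by (simp add: complete_graph_def)
  qed
qed simp

lemma finite_pverts_complete_product: "finite (pverts (cart_prod_list (map complete_graph ns)))"
  by (induction ns) (auto simp: relabel_def cart_prod_def complete_graph_def)

lemma parcs_complete_product_iff:
  "(xs, ys) \<in> parcs (cart_prod_list (map complete_graph ns)) \<longleftrightarrow>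
     list_all2 (<) xs ns \<and> list_all2 (<) ys ns \<and> hamming xs ys = 1"
proof (induction ns arbitrary: xs ys)
  case (Cons n ns)
  show ?case
  proof (cases "xs = [] \<or> ys = []")
    case True
    then show ?thesis
      by (auto simp: relabel_def)
  next
    case False
    then obtain x xs' y ys' where [simp]: "xs = x # xs'" "ys = y # ys'"
      by (meson list.exhaust)
    \<comment> \<open>If the heads differ, distance 1 leaves distance 0 for the tails; this means
      equal tails because both have the length of \<open>ns\<close>.\<close>
    have "hamming xs' ys' = 0 \<longleftrightarrow> xs' = ys'" if "list_all2 (<) xs' ns" "list_all2 (<) ys' ns"
      using that by (intro hamming_eq_0_iff) (auto dest!: list_all2_lengthD)
    moreover have "(xs, ys) \<in> parcs (cart_prod_list (map complete_graph (n # ns))) \<longleftrightarrow>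
        x < n \<and> x = y \<and> list_all2 (<) xs' ns \<and> list_all2 (<) ys' ns \<and> hamming xs' ys' = 1 \<or>
        x < n \<and> y < n \<and> x \<noteq> y \<and> list_all2 (<) xs' ns \<and> xs' = ys'"
      unfolding \<open>xs = x # xs'\<close> \<open>ys = y # ys'\<close> list.map parcs_cart_prod_list_Cons Cons.IH
        pverts_complete_product_iff by (simp add: complete_graph_def)
    ultimately show ?thesis
      by (cases "x = y") auto
  qed
qed simp

lemma hamming_le_vwalk_length:
  assumes "vwalk p (with_proj (cart_prod_list (map complete_graph ns)))"
  shows "hamming (hd p) (last p) \<le> vwalk_length p"
proof -
  \<comment> \<open>Each arc adds at most 1. The first conjunct is carried along to supply the equal
    lengths for the triangle inequality.\<close>
  have "list_all2 (<) (last p) ns \<and> hamming (hd p) (last p) \<le> length p - 1"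
    using assms
  proof (induction p rule: vwalk_induct)
    case (Base u)
    then show ?case
      by (simp add: pverts_complete_product_iff)
  next
    case (Cons u v es)
    let ?l = "last (v # es)"
    have uv: "list_all2 (<) u ns" "list_all2 (<) v ns" "hamming u v = 1"
      using Cons.hyps by (auto simp: parcs_complete_product_iff)
    have "hamming u ?l \<le> hamming u v + hamming v ?l"
      using uv Cons.IH by (intro hamming_triangle) (auto dest!: list_all2_lengthD)
    then show ?case
      using Cons.IH uv by auto
  qed
  then show ?thesis
    by simp
qed

text \<open>The first entry of \<open>xs\<close> that differs from \<open>ys\<close> is replaced by
  that of \<open>ys\<close>. Iterating this gives a geodesic.\<close>

lemma hamming_step:
  assumes "list_all2 (<) xs ns" "list_all2 (<) ys ns" "hamming xs ys = Suc h"
  shows "\<exists>zs. list_all2 (<) zs ns \<and> hamming xs zs = 1 \<and> hamming zs ys = h"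
  using assms
proof (induction ns arbitrary: xs ys rule: list.induct)
  case (Cons n ns)
  then obtain x xs' y ys' where [simp]: "xs = x # xs'" "ys = y # ys'"
    by (auto simp: list_all2_Cons2)
  show ?case
  proof (cases "x = y")
    case True
    then obtain zs where "list_all2 (<) zs ns" "hamming xs' zs = 1" "hamming zs ys' = h"
      using Cons by auto
    then show ?thesis
      using True Cons.prems by (intro exI[of _ "x # zs"]) auto
  next
    case False
    then show ?thesis
      using Cons.prems by (intro exI[of _ "y # xs'"]) auto
  qed
qed simp

lemma vwalk_hamming_exists:
  fixes ns :: "nat list"
  defines "G \<equiv> cart_prod_list (map complete_graph ns)"
  assumes "xs \<in> pverts G" "ys \<in> pverts G"
  shows "\<exists>p. vwalk p (with_proj G) \<and> hd p = xs \<and> last p = ys \<and> vwalk_length p = hamming xs ys"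
  using assms(2,3)
proof (induction "hamming xs ys" arbitrary: xs)
  case 0
  then have "xs = ys"
    using hamming_eq_0_iff[of xs ys] unfolding G_def pverts_complete_product_iff
    by (metis list_all2_lengthD)
  with 0 show ?case
    by (intro exI[of _ "[xs]"]) auto
next
  case (Suc h)
  then obtain zs where zs: "list_all2 (<) zs ns" "hamming xs zs = 1" "hamming zs ys = h"
    using hamming_step[of xs ns ys h] by (auto simp: G_def pverts_complete_product_iff)
  then obtain p where p: "vwalk p (with_proj G)" "hd p = zs" "last p = ys" "length p - 1 = h"
    using Suc.hyps(1)[of zs] Suc.prems by (auto simp: G_def pverts_complete_product_iff)
  have "(xs, zs) \<in> parcs G"
    using zs Suc.prems by (simp add: G_def pverts_complete_product_iff parcs_complete_product_iff)
  then have "vwalk (xs # p) (with_proj G)"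
    using p Suc.prems by (intro vwalk_consI) auto
  moreover have "p \<noteq> []"
    using p by auto
  moreover have "Suc (length p - 1) = length p"
    using \<open>p \<noteq> []\<close> by (cases p) auto
  ultimately show ?case
    using p Suc.hyps(2) by (intro exI[of _ "xs # p"]) auto
qed

text \<open>Negating coordinatewise betweenness removes walks from the problem: each vertex, taken
  as the middle of a triple, needs one coordinate that separates it from both others.\<close>

lemma general_position_complete_product_iff:
  fixes ns :: "nat list"
  defines "G \<equiv> cart_prod_list (map complete_graph ns)"
  shows "general_position G S \<longleftrightarrow> S \<subseteq> pverts G \<and>
    (\<forall>x\<in>S. \<forall>y\<in>S. \<forall>z\<in>S. distinct [x, y, z] \<longrightarrow>
      (\<exists>i<length ns. y ! i \<noteq> x ! i \<and> y ! i \<noteq> z ! i))"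
proof -
  have "hamming x z = hamming x y + hamming y z \<longleftrightarrow>
      (\<forall>i<length ns. y ! i = x ! i \<or> y ! i = z ! i)"
    if "x \<in> pverts G" "y \<in> pverts G" "z \<in> pverts G" for x y z
    using that hamming_between_iff[of x y z]
    by (auto simp: G_def pverts_complete_product_iff dest!: list_all2_lengthD)
  moreover have "general_position G S \<longleftrightarrow> S \<subseteq> pverts G \<and>
    (\<forall>x\<in>S. \<forall>y\<in>S. \<forall>z\<in>S. distinct [x, y, z] \<longrightarrow> hamming x z \<noteq> hamming x y + hamming y z)"
    unfolding G_def
    by (rule general_position_iff_no_between) (fact hamming_le_vwalk_length vwalk_hamming_exists)+
  ultimately show ?thesis
    by (smt (verit) subset_iff)
qed

section \<open>Lower bound: small sets can be extended\<close>

lemma Min_le_card_maximal_general_position: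
  fixes ns :: "nat list"
  defines "G \<equiv> cart_prod_list (map complete_graph ns)"
  assumes "ns \<noteq> []" and S: "maximal_general_position G S"
  shows "Min (set ns) \<le> card S"
proof (rule ccontr)
  assume less: "\<not> Min (set ns) \<le> card S"
  have gp: "general_position G S"
    using S by (simp add: maximal_general_position_def)
  then have "finite S"
    using finite_pverts_complete_product finite_subset
    unfolding G_def general_position_def by blast
  \<comment> \<open>Otherwise the projection of \<open>S\<close> to coordinate \<open>i\<close>
    would be onto, and \<open>S\<close> would have at least \<open>ns ! i\<close> elements.\<close>
  have "\<exists>c<ns ! i. c \<notin> (\<lambda>x. x ! i) ` S" if "i < length ns" for i
  proof (rule ccontr)
    assume "\<not> (\<exists>c<ns ! i. c \<notin> (\<lambda>x. x ! i) ` S)"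
    then have "{..<ns ! i} \<subseteq> (\<lambda>x. x ! i) ` S"
      by auto
    then have "ns ! i \<le> card S"
      using \<open>finite S\<close> surj_card_le by fastforce
    then show False
      using less that by (meson List.finite_set Min_le le_trans nth_mem)
  qed
  then obtain c where c: "\<And>i. i < length ns \<Longrightarrow> c i < ns ! i \<and> c i \<notin> (\<lambda>x. x ! i) ` S"
    by metis
  define w where "w = map c [0..<length ns]"
  have w: "w ! i \<noteq> x ! i" if "i < length ns" "x \<in> S" for i x
    using c[OF that(1)] that by (auto simp: w_def)
  have "w \<in> pverts G"
    using c by (simp add: w_def G_def pverts_complete_product_iff list_all2_conv_all_nth)
  have len: "length x = length ns" if "x \<in> S" for x
    using that gp unfolding general_position_def G_def
    by (metis list_all2_lengthD pverts_complete_product_iff subsetD)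
  have "\<exists>i<length ns. y ! i \<noteq> x ! i \<and> y ! i \<noteq> z ! i"
    if xyz: "x \<in> insert w S" "y \<in> insert w S" "z \<in> insert w S" "distinct [x, y, z]" for x y z
  proof -
    have differ: "\<exists>i<length ns. u ! i \<noteq> v ! i" if "u \<in> S" "v \<in> S" "u \<noteq> v" for u v
      using that len by (metis nth_equalityI)
    \<comment> \<open>A middle vertex \<open>w\<close> is separated from the others in every
      coordinate. If \<open>w\<close> is an end, any coordinate in which the two members of
      \<open>S\<close> differ works, since \<open>w\<close> differs from the middle one there
      too.\<close>
    consider "y = w" | "x = w" "y \<in> S" "z \<in> S" | "z = w" "y \<in> S" "x \<in> S"
      | "x \<in> S" "y \<in> S" "z \<in> S"
      using xyz by auto
    then show ?thesis
    proof cases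
      case 1
      then show ?thesis
        using xyz w[of 0] \<open>ns \<noteq> []\<close> by (intro exI[of _ 0]) auto
    next
      case 2
      then show ?thesis
        using xyz w differ[of y z] by (metis distinct_length_2_or_more)
    next
      case 3
      then show ?thesis
        using xyz w differ[of y x] by (metis distinct_length_2_or_more)
    next
      case 4
      then show ?thesis
        using xyz gp unfolding G_def general_position_complete_product_iff by blast
    qed
  qed
  then have "general_position G (insert w S)"
    using \<open>w \<in> pverts G\<close> gp
    unfolding G_def general_position_complete_product_iff by blast
  then have "w \<in> S"
    using S unfolding maximal_general_position_def by blast
  \<comment> \<open>The avoidance property, applied to \<open>w\<close> itself, would give
    \<open>w ! 0 \<noteq> w ! 0\<close>.\<close>
  then show False
    using w[of 0 w] \<open>ns \<noteq> []\<close> by simp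
qed

section \<open>Upper bound: coordinate lines are maximal\<close>

text \<open>The line through the zero vertex in any direction \<open>j\<close> is maximal; a
  smallest factor is chosen only in the theorem.\<close>

lemma maximal_general_position_line:
  fixes ns :: "nat list"
  defines "G \<equiv> cart_prod_list (map complete_graph ns)"
  assumes pos: "\<forall>n\<in>set ns. n \<ge> 1"
    and triv: "1 \<in> set ns \<longrightarrow> (\<forall>n\<in>set ns. n = 1)"
    and j: "j < length ns"
  shows "maximal_general_position G ((\<lambda>a. (replicate (length ns) 0)[j := a]) ` {..<ns ! j})"
proof -
  define p where "p a = (replicate (length ns) 0)[j := a]" for a :: nat
  have p_nth: "p a ! i = (if i = j then a else 0)" if "i < length ns" for a i
    using that by (auto simp: p_def nth_list_update)
  have "p a \<in> pverts G" if "a < ns ! j" for a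
    unfolding G_def pverts_complete_product_iff list_all2_conv_all_nth
  proof (intro conjI allI impI)
    show "length (p a) = length ns"
      by (simp add: p_def)
    show "p a ! i < ns ! i" if "i < length (p a)" for i
    proof -
      have i: "i < length ns"
        using that by (simp add: p_def)
      then have "1 \<le> ns ! i"
        using pos by simp
      then show ?thesis
        using i \<open>a < ns ! j\<close> by (simp add: p_nth)
    qed
  qed
  then have "p ` {..<ns ! j} \<subseteq> pverts G"
    by auto
  moreover have "\<exists>i<length ns. y ! i \<noteq> x ! i \<and> y ! i \<noteq> z ! i"
    if "x \<in> p ` {..<ns ! j}" "y \<in> p ` {..<ns ! j}" "z \<in> p ` {..<ns ! j}" "distinct [x, y, z]"
    for x y z
    \<comment> \<open>Distinct points of the line differ in coordinate \<open>j\<close>, so it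
      separates every triple.\<close>
    using that j by (intro exI[of _ j]) (auto simp: p_nth)
  ultimately have gp: "general_position G (p ` {..<ns ! j})"
    unfolding G_def general_position_complete_product_iff by blast
  have "w \<in> p ` {..<ns ! j}"
    if T: "general_position G T" "p ` {..<ns ! j} \<subseteq> T" and "w \<in> T" for T w
  proof (rule ccontr)
    assume w: "w \<notin> p ` {..<ns ! j}"
    have "list_all2 (<) w ns"
      using T \<open>w \<in> T\<close> unfolding general_position_def G_def
      by (auto simp: pverts_complete_product_iff)
    then have w_less: "\<And>i. i < length ns \<Longrightarrow> w ! i < ns ! i" and w_len: "length w = length ns"
      by (auto simp: list_all2_conv_all_nth)
    define a where "a = w ! j"
    have a: "a < ns ! j"
      using w_less j by (simp add: a_def)
    \<comment> \<open>A line with a single point has no second point \<open>b\<close> for the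
      argument below. By \<open>triv\<close> this case means that all factors are trivial, and then
      \<open>w\<close> is the only vertex, \<open>p 0\<close>.\<close>
    have "ns ! j \<noteq> 1"
    proof
      assume "ns ! j = 1"
      then have "1 \<in> set ns"
        using j nth_mem by metis
      then have "w ! i = 0" if "i < length ns" for i
        using triv that w_less[OF that] nth_mem[OF that] by (metis less_one)
      then have "w = p 0"
        using w_len p_nth by (intro nth_equalityI) (auto simp: p_def)
      then show False
        using w \<open>ns ! j = 1\<close> by simp
    qed
    then obtain b where b: "b < ns ! j" "b \<noteq> a"
      using a by (cases "a = 0") (auto intro: that[of 0] that[of 1])
    have "p a \<noteq> p b"
      using p_nth[OF j] b(2) by metis
    moreover have "p a \<in> T" "p b \<in> T" "w \<noteq> p a" "w \<noteq> p b"
      using T a b w by auto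
    \<comment> \<open>\<open>p a\<close> is the projection of \<open>w\<close>: it agrees with
      \<open>w\<close> in coordinate \<open>j\<close> and with \<open>p b\<close>, both being 0, in
      all others. So no coordinate separates it from both.\<close>
    ultimately have "\<exists>i<length ns. p a ! i \<noteq> w ! i \<and> p a ! i \<noteq> p b ! i"
      using T(1) \<open>w \<in> T\<close> unfolding G_def general_position_complete_product_iff by auto
    then show False
      by (auto simp: p_nth a_def split: if_splits)
  qed
  then show ?thesis
    using gp unfolding maximal_general_position_def p_def by blast
qed

theorem theorem2p6:
  fixes ns :: "nat list"
  assumes "ns \<noteq> []"
    and "\<forall>n \<in> set ns. n \<ge> 1"
    and "1 \<in> set ns \<longrightarrow> (\<forall>n \<in> set ns. n = 1)"
  shows "gp_minus (cart_prod_list (map complete_graph ns)) = Min (set ns)"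
  unfolding gp_minus_def
proof (rule Least_equality)
  have "Min (set ns) \<in> set ns"
    using assms(1) by simp
  then obtain j where j: "j < length ns" "ns ! j = Min (set ns)"
    by (auto simp: in_set_conv_nth)
  \<comment> \<open>Entry \<open>j\<close> recovers the parameter, so the line in the direction of a
    smallest factor has exactly \<open>Min (set ns)\<close> points.\<close>
  have "inj_on (\<lambda>a. (replicate (length ns) 0)[j := a]) {..<ns ! j}"
    using j(1) by (intro inj_onI) (metis length_replicate nth_list_update_eq)
  then have "card ((\<lambda>a. (replicate (length ns) 0)[j := a]) ` {..<ns ! j}) = Min (set ns)"
    using j(2) by (simp add: card_image)
  then show "\<exists>S. maximal_general_position (cart_prod_list (map complete_graph ns)) S \<and>
      card S = Min (set ns)"
    using maximal_general_position_line[OF assms(2,3) j(1)] by blast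
next
  fix m
  assume "\<exists>S. maximal_general_position (cart_prod_list (map complete_graph ns)) S \<and> card S = m"
  then show "Min (set ns) \<le> m"
    using Min_le_card_maximal_general_position[OF assms(1)] by blast
qed

end
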